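(* Let $\mathcal{X}=\overline{(X,0)}$ and $\mathcal{Y}=\overline{(Y,0)}$ be in $\overline{\mathbb{IR}}^{+}$ with $X=[x_1,x_2]$, $Y=[y_1,y_2]$, $x_1>0$ and $y_1>0$. If $\dfrac{y_2}{y_1}\ge\dfrac{x_2}{x_1}$, then there exists a unique $\mathcal{Z}=\overline{(Z,0)}\in\overline{\mathbb{IR}}^{+}$ such that $\mathcal{Y}=\mathcal{X}\mathcal{Z}$.
   Context: $\mathbb{IR}$ is the set of closed bounded intervals $[a,b]$ of $\mathbb{R}$, $a\le b$, with $0=[0,0]$ and addition $[a,b]+[c,d]=[a+c,b+d]$. $\overline{\mathbb{IR}}$ is the quotient of $\mathbb{IR}\times\mathbb{IR}$ by $(x,y)\sim(z,t)\iff x+t=y+z$, with classes $\overline{(x,y)}$. $\overline{\mathbb{IR}}^{+}$ is the subset of elements $\overline{(X,0)}$ with $X=[x_1,x_2]\in\mathbb{IR}$ and $0\le x_1$. The product is $\overline{(X,0)}\,\overline{(Z,0)}=\overline{(XZ,0)}$, where $XZ$ is the classical interval product $[\min S,\max S]$, $S=\{x_1z_1,x_1z_2,x_2z_1,x_2z_2\}$ for $X=[x_1,x_2]$, $Z=[z_1,z_2]$ (so $XZ=[x_1z_1,x_2z_2]$ when $x_1,z_1\ge0$). *)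

theory Defs
  imports Complex_Main "HOL-Library.Interval"
begin

text \<open>
  Closed bounded real intervals are the type \<^typ>\<open>real interval\<close>: \<open>X = [lower X, upper X]\<close>,
  nonempty by construction, with endpointwise addition, \<open>0 = [0, 0]\<close>, and \<open>*\<close> the classical
  product (minimum and maximum of the four endpoint products).
\<close>

definition gint_rel :: "real interval \<times> real interval \<Rightarrow> real interval \<times> real interval \<Rightarrow> bool" where
  "gint_rel p q \<longleftrightarrow> fst p + snd q = snd p + fst q"

lemma gint_rel_iff [simp]: "gint_rel (x, y) (z, t) \<longleftrightarrow> x + t = y + z"
  by (simp add: gint_rel_def)

lemma equivp_gint_rel: "equivp gint_rel"
proof (rule equivpI)
  show "reflp gint_rel"
    by (auto simp: reflp_def gint_rel_def add.commute)
  show "symp gint_rel"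
    by (auto simp: symp_def gint_rel_def add.commute)
  show "transp gint_rel"
    by (auto simp: transp_def gint_rel_def interval_eq_iff)
qed

quotient_type gint = "real interval \<times> real interval" / gint_rel
  morphisms rep_gint cls
  by (rule equivp_gint_rel)

lemma cls_eq_iff: "cls (x, y) = cls (z, t) \<longleftrightarrow> x + t = y + z"
  by (simp add: gint.abs_eq_iff)

definition gint_pos :: "gint set" where
  "gint_pos = {cls (X, 0) | X. 0 \<le> lower X}"

text \<open>
  The product is only meaningful when both factors are of the form \<open>cls (X, 0)\<close>; on other
  arguments its value is unspecified. The lemma \<open>gint_mult_cls\<close> shows that it is well defined.
\<close>

definition gint_mult :: "gint \<Rightarrow> gint \<Rightarrow> gint"  (infixl \<open>\<odot>\<close> 70) where
  "A \<odot> B = (THE C. \<exists>X Z. A = cls (X, 0) \<and> B = cls (Z, 0) \<and> C = cls (X * Z, 0))"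

lemma cls_zero_eq_iff: "cls (X, 0) = cls (Z, 0) \<longleftrightarrow> X = Z"
  by (simp add: cls_eq_iff)

lemma gint_mult_cls: "cls (X, 0) \<odot> cls (Z, 0) = cls (X * Z, 0)"
  unfolding gint_mult_def by (rule the_equality) (auto simp: cls_zero_eq_iff)

end

theory Submission
  imports Defs
begin

text \<open>
  A class \<open>cls (X, 0)\<close> determines the interval \<open>X\<close>, so the equation \<open>\<Y> = \<X> \<odot> \<Z>\<close> in the
  nonnegative part of the quotient is the equation \<open>X * Z = Y\<close> between intervals with nonnegative
  lower endpoints. On such intervals the product acts endpointwise
  (\<open>lower_times_nonneg\<close>, \<open>upper_times_nonneg\<close>), so for \<open>X\<close> with positive endpoints the equation
  forces the endpoints of \<open>Z\<close> to be the quotients of those of \<open>Y\<close> and \<open>X\<close>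
  (\<open>times_eq_iff_endpoint_quotients\<close>). This gives uniqueness. The
  hypothesis on the ratios, cross-multiplied, says that the two quotients are in increasing order,
  that is, that they bound an interval; this gives existence.
\<close>

lemma ex_interval_with_endpoints:
  fixes a b :: "'a::preorder"
  assumes "a \<le> b"
  shows "\<exists>Z. lower Z = a \<and> upper Z = b"
  using assms by (intro exI[of _ "Interval (a, b)"])
    (simp add: lower.rep_eq upper.rep_eq Interval_inverse)

lemma lower_times_nonneg:
  fixes X Z :: "real interval"
  assumes "0 \<le> lower X" and "0 \<le> lower Z"
  shows "lower (X * Z) = lower X * lower Z"
proof -
  have "lower X \<le> upper X" "lower Z \<le> upper Z" by simp_all
  moreover from this assms have "0 \<le> upper X" "0 \<le> upper Z" by linarith+
  ultimately have "lower X * lower Z \<le> lower X * upper Z" "lower X * lower Z \<le> upper X * lower Z"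
      "lower X * lower Z \<le> upper X * upper Z"
    using assms by (auto intro!: mult_mono)
  then show ?thesis
    by (simp add: lower_times min_def)
qed

lemma upper_times_nonneg:
  fixes X Z :: "real interval"
  assumes "0 \<le> lower X" and "0 \<le> lower Z"
  shows "upper (X * Z) = upper X * upper Z"
proof -
  have "lower X \<le> upper X" "lower Z \<le> upper Z" by simp_all
  moreover from this assms have "0 \<le> upper X" "0 \<le> upper Z" by linarith+
  ultimately have "lower X * lower Z \<le> upper X * upper Z" "lower X * upper Z \<le> upper X * upper Z"
      "upper X * lower Z \<le> upper X * upper Z"
    using assms by (auto intro!: mult_mono)
  then show ?thesis
    by (simp add: upper_times max_def)
qed

lemma times_eq_iff_endpoint_quotients:
  fixes X Y Z :: "real interval"
  assumes "0 < lower X" and "0 \<le> lower Z"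
  shows "X * Z = Y \<longleftrightarrow> lower Z = lower Y / lower X \<and> upper Z = upper Y / upper X"
proof -
  have "0 < upper X"
    using assms(1) lower_le_upper[of X] by linarith
  then show ?thesis
    using assms
    by (auto simp: interval_eq_iff lower_times_nonneg upper_times_nonneg field_simps)
qed

theorem proposition21:
  fixes \<X> \<Y> :: gint and X Y :: "real interval"
  assumes "\<X> = cls (X, 0)" and "\<X> \<in> gint_pos"
    and "\<Y> = cls (Y, 0)" and "\<Y> \<in> gint_pos"
    and "lower X > 0" and "lower Y > 0"
    and "upper Y / lower Y \<ge> upper X / lower X"
  shows "\<exists>!\<Z>. \<Z> \<in> gint_pos \<and> \<Y> = \<X> \<odot> \<Z>"
proof -
  have upX: "0 < upper X"
    using \<open>lower X > 0\<close> lower_le_upper[of X] by linarith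
  have "lower Y / lower X \<le> upper Y / upper X"
    using assms(5-7) upX by (simp add: field_simps)
  then obtain Z where lowZ: "lower Z = lower Y / lower X" and upZ: "upper Z = upper Y / upper X"
    by (rule ex_interval_with_endpoints[THEN exE]) blast
  have nonnegZ: "0 \<le> lower Z"
    using lowZ assms(5,6) by simp
  show ?thesis
  proof (rule ex1I)
    have "X * Z = Y"
      using times_eq_iff_endpoint_quotients[OF \<open>lower X > 0\<close> nonnegZ] lowZ upZ by blast
    then show "cls (Z, 0) \<in> gint_pos \<and> \<Y> = \<X> \<odot> cls (Z, 0)"
      using nonnegZ by (auto simp: gint_pos_def assms(1,3) gint_mult_cls)
  next
    fix \<W>
    assume W: "\<W> \<in> gint_pos \<and> \<Y> = \<X> \<odot> \<W>"
    then obtain W where \<W>: "\<W> = cls (W, 0)" and nonnegW: "0 \<le> lower W"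
      by (auto simp: gint_pos_def)
    have "X * W = Y"
      using W by (simp add: \<W> assms(1,3) gint_mult_cls cls_zero_eq_iff)
    then have "W = Z"
      using times_eq_iff_endpoint_quotients[OF \<open>lower X > 0\<close> nonnegW, of Y] lowZ upZ
      by (simp add: interval_eqI)
    then show "\<W> = cls (Z, 0)"
      by (simp add: \<W>)
  qed
qed

end
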